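(* For any $\alpha\ge2$ and $n\ge2$, there exists a class $\mathcal{F}$ of $n$-vertex graphs such that any distance-$(1,\alpha)$ labelling scheme for $\mathcal{F}$ requires labels of size at least $\tfrac19 n^{1/\alpha}$ (i.e., some vertex of some graph of $\mathcal{F}$ receives a label of at least $\tfrac19 n^{1/\alpha}$ bits).
   Context: A distance-$(1,\alpha)$ labelling scheme for $\mathcal{F}$ consists of a decoder $D:\{0,1\}^*\times\{0,1\}^*\to\{0,1\}$ such that every $G\in\mathcal{F}$ has a deterministic labelling $\ell:V(G)\to\{0,1\}^*$ with, for all $x,y\in V(G)$: $D(\ell(x),\ell(y))=1$ if $\mathsf{dist}_G(x,y)\le1$ and $D(\ell(x),\ell(y))=0$ if $\mathsf{dist}_G(x,y)>\alpha$ (no requirement otherwise). $\mathsf{dist}_G$ is shortest-path distance, infinite between different components. *)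

theory Defs
  imports "Graph_Theory.Graph_Theory"
begin

text \<open>
  A finite simple undirected graph is a \<^locale>\<open>pair_graph\<close>: a finite vertex set with a
  symmetric, irreflexive set of ordered pairs as edges. Graphs have natural numbers as
  vertices, with an arbitrary finite vertex set. As usual, a graph class is closed under
  isomorphism.
\<close>

definition graph_class :: "nat pair_pre_digraph set \<Rightarrow> bool" where
  "graph_class F \<longleftrightarrow>
     (\<forall>G\<in>F. pair_graph G) \<and>
     (\<forall>G\<in>F. \<forall>H. digraph_iso (with_proj G) (with_proj H) \<longrightarrow> H \<in> F)"

text \<open>
  The library's shortest-path cost with unit edge weights; it is the infimum over all walks
  in \<^typ>\<open>ereal\<close>, hence infinite when there is no walk.
\<close>

definition graph_dist :: "'a pair_pre_digraph \<Rightarrow> 'a \<Rightarrow> 'a \<Rightarrow> ereal" where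
  "graph_dist G x y = wf_digraph.\<mu> (with_proj G) (\<lambda>_. 1) x y"

type_synonym bitstring = "bool list"

definition distance_labelling ::
  "real \<Rightarrow> (bitstring \<Rightarrow> bitstring \<Rightarrow> bool) \<Rightarrow> 'a pair_pre_digraph \<Rightarrow> ('a \<Rightarrow> bitstring) \<Rightarrow> bool" where
  "distance_labelling \<alpha> D G l \<longleftrightarrow>
     (\<forall>x\<in>pverts G. \<forall>y\<in>pverts G.
        (graph_dist G x y \<le> 1 \<longrightarrow> D (l x) (l y)) \<and>
        (graph_dist G x y > ereal \<alpha> \<longrightarrow> \<not> D (l x) (l y)))"

text \<open>
  One decoder \<open>D\<close> serves the whole class, while the labelling \<open>L G\<close> may depend on all of \<open>G\<close>.
\<close>

definition distance_labelling_scheme ::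
  "real \<Rightarrow> 'a pair_pre_digraph set \<Rightarrow> (bitstring \<Rightarrow> bitstring \<Rightarrow> bool) \<Rightarrow>
   ('a pair_pre_digraph \<Rightarrow> 'a \<Rightarrow> bitstring) \<Rightarrow> bool" where
  "distance_labelling_scheme \<alpha> F D L \<longleftrightarrow> (\<forall>G\<in>F. distance_labelling \<alpha> D G (L G))"

end

theory Submission
  imports Defs
begin

text \<open>
  Take all graphs on \<open>n\<close> vertices and let \<open>a = \<lfloor>\<alpha>\<rfloor>\<close>. If a graph has girth at least \<open>a + 2\<close>, then
  deleting an edge puts its endpoints at distance more than \<open>\<alpha>\<close>, so a labelling of a subgraph
  determines which edges were kept. Hence a graph of girth at least \<open>a + 2\<close> with \<open>m\<close> edges forces
  \<open>2 ^ m \<le> 2 ^ ((l + 1) * n)\<close> when all labels have at most \<open>l\<close> bits.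

  For \<open>a \<ge> 3\<close>, a dense such graph is a maximal one among those of maximum degree at most \<open>d = 6 * l\<close>:
  any two vertices of degree less than \<open>d\<close> are at distance at most \<open>a\<close>, since otherwise they
  could be joined, so there are at most \<open>d ^ a\<close> of them. For \<open>a = 2\<close> this is too weak by a constant
  factor, and the balanced complete bipartite graph is used. For \<open>l = 0\<close> the edgeless graph already
  gives a contradiction.
\<close>

section \<open>Walks of bounded length\<close>

text \<open>Bare relations make adding and deleting edges plain set operations; the link to
  \<open>graph_dist\<close> is made only in \<open>graph_dist_greater\<close>.\<close>

definition walk_le :: "'a rel \<Rightarrow> nat \<Rightarrow> 'a rel" where
  "walk_le E k = (\<Union>i\<le>k. E ^^ i)"

lemma walk_leI: "(x, y) \<in> E ^^ i \<Longrightarrow> i \<le> k \<Longrightarrow> (x, y) \<in> walk_le E k"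
  by (auto simp: walk_le_def)

lemma relpow_mono: "E \<subseteq> E' \<Longrightarrow> E ^^ k \<subseteq> E' ^^ k" for E E' :: "'a rel"
  by (induction k) (auto simp: relcomp_mono)

lemma walk_le_mono: "E \<subseteq> E' \<Longrightarrow> walk_le E k \<subseteq> walk_le E' k"
  unfolding walk_le_def by (intro UN_mono relpow_mono) auto

lemma relpow_sym: "sym E \<Longrightarrow> (x, y) \<in> E ^^ i \<Longrightarrow> (y, x) \<in> E ^^ i"
proof (induction i arbitrary: y)
  case (Suc i)
  then obtain z where "(x, z) \<in> E ^^ i" "(z, y) \<in> E"
    by auto
  with Suc show ?case
    by (meson relpow_Suc_I2 symD)
qed auto

lemma walk_le_sym: "sym E \<Longrightarrow> (x, y) \<in> walk_le E k \<Longrightarrow> (y, x) \<in> walk_le E k"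
  unfolding walk_le_def using relpow_sym by fastforce

text \<open>One traversal of the new edge is enough: the stretch between two traversals can be cut
  out. In the induction on the first step, a walk returning to \<open>u\<close> restarts at its
  remaining crossing, and one starting at \<open>v\<close> skips that crossing altogether.\<close>

lemma relpow_insert_edge:
  assumes "(x, y) \<in> (E \<union> {(u, v), (v, u)}) ^^ k"
  shows "(x, y) \<in> walk_le E k \<or>
    (\<exists>i j. i + j + 1 \<le> k \<and>
      ((x, u) \<in> E ^^ i \<and> (v, y) \<in> E ^^ j \<or> (x, v) \<in> E ^^ i \<and> (u, y) \<in> E ^^ j))"
  using assms
proof (induction k arbitrary: x)
  case 0
  then show ?case by (auto simp: walk_le_def)
next
  case (Suc k)
  then obtain z where z: "(x, z) \<in> E \<union> {(u, v), (v, u)}"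
      "(z, y) \<in> (E \<union> {(u, v), (v, u)}) ^^ k"
    by (meson relpow_Suc_D2)
  have short: "(p, y) \<in> walk_le E (Suc k)" if "(p, y) \<in> E ^^ j" "i + j + 1 \<le> k" for p i j
    using that by (auto intro: walk_leI)
  have first: "(x, y) \<in> E ^^ Suc j" if "(x, z) \<in> E" "(z, y) \<in> E ^^ j" for j y
    using that by (meson relpow_Suc_I2)
  from Suc.IH[OF z(2)] show ?case
  proof (elim disjE exE conjE)
    assume "(z, y) \<in> walk_le E k"
    then obtain j where j: "j \<le> k" "(z, y) \<in> E ^^ j"
      by (auto simp: walk_le_def)
    consider "(x, z) \<in> E" | "x = u" "z = v" | "x = v" "z = u"
      using z(1) by auto
    then show ?thesis
    proof cases
      case 1
      then show ?thesis using first[OF 1 j(2)] j(1) by (auto intro: walk_leI simp del: relpow.simps)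
    next
      case 2
      then have "0 + j + 1 \<le> Suc k \<and> (x, u) \<in> E ^^ 0 \<and> (v, y) \<in> E ^^ j" using j by auto
      then show ?thesis by blast
    next
      case 3
      then have "0 + j + 1 \<le> Suc k \<and> (x, v) \<in> E ^^ 0 \<and> (u, y) \<in> E ^^ j" using j by auto
      then show ?thesis by blast
    qed
  next
    fix i j
    assume ij: "i + j + 1 \<le> k" "(z, u) \<in> E ^^ i" "(v, y) \<in> E ^^ j"
    consider "(x, z) \<in> E" | "x = u" | "x = v"
      using z(1) by auto
    then show ?thesis
    proof cases
      case 1
      then have "Suc i + j + 1 \<le> Suc k \<and> (x, u) \<in> E ^^ Suc i \<and> (v, y) \<in> E ^^ j"
        using first[OF 1 ij(2)] ij by auto
      then show ?thesis by blast
    next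
      case 2
      then have "0 + j + 1 \<le> Suc k \<and> (x, u) \<in> E ^^ 0 \<and> (v, y) \<in> E ^^ j" using ij by auto
      then show ?thesis by blast
    next
      case 3
      then show ?thesis using short ij by blast
    qed
  next
    fix i j
    assume ij: "i + j + 1 \<le> k" "(z, v) \<in> E ^^ i" "(u, y) \<in> E ^^ j"
    consider "(x, z) \<in> E" | "x = v" | "x = u"
      using z(1) by auto
    then show ?thesis
    proof cases
      case 1
      then have "Suc i + j + 1 \<le> Suc k \<and> (x, v) \<in> E ^^ Suc i \<and> (u, y) \<in> E ^^ j"
        using first[OF 1 ij(2)] ij by auto
      then show ?thesis by blast
    next
      case 2
      then have "0 + j + 1 \<le> Suc k \<and> (x, v) \<in> E ^^ 0 \<and> (u, y) \<in> E ^^ j" using ij by auto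
      then show ?thesis by blast
    next
      case 3
      then show ?thesis using short ij by blast
    qed
  qed
qed

lemma finite_relpow_Image:
  fixes E :: "'a rel"
  assumes "finite E"
  shows "finite ((E ^^ k) `` {u})"
proof (cases k)
  case (Suc j)
  then have "(E ^^ k) `` {u} \<subseteq> Range E"
    by auto
  then show ?thesis
    using finite_subset finite_Range[OF assms] by blast
qed simp

text \<open>
  The strict inequality at the centre makes the bound exactly \<open>d ^ k\<close>; the lower order terms of a
  cruder bound would be too large for the final computation.
\<close>

lemma card_walk_le_bound:
  assumes fin: "finite E" and deg: "\<And>v. card (E `` {v}) \<le> d" and u: "card (E `` {u}) < d"
  shows "card (walk_le E k `` {u}) \<le> d ^ k"
proof -
  \<comment> \<open>At most \<open>d - 1\<close> first steps leave \<open>u\<close>, and each later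
    step has at most \<open>d\<close> choices. The sum over all lengths then telescopes.\<close>
  have sphere: "card ((E ^^ Suc k) `` {u}) \<le> (d - 1) * d ^ k" for k
  proof (induction k)
    case 0
    then show ?case using u by simp
  next
    case (Suc k)
    have "(E ^^ Suc (Suc k)) `` {u} = (\<Union>v\<in>(E ^^ Suc k) `` {u}. E `` {v})"
      by auto
    also have "card \<dots> \<le> (\<Sum>v\<in>(E ^^ Suc k) `` {u}. card (E `` {v}))"
      by (rule card_UN_le[OF finite_relpow_Image[OF fin]])
    also have "\<dots> \<le> card ((E ^^ Suc k) `` {u}) * d"
      using sum_bounded_above[of "(E ^^ Suc k) `` {u}" "\<lambda>v. card (E `` {v})" d] deg by simp
    also have "\<dots> \<le> (d - 1) * d ^ k * d"
      using Suc by (rule mult_right_mono) simp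
    finally show ?case by (simp add: ac_simps)
  qed
  show ?thesis
  proof (induction k)
    case 0
    then show ?case by (simp add: walk_le_def)
  next
    case (Suc k)
    have "walk_le E (Suc k) `` {u} = walk_le E k `` {u} \<union> (E ^^ Suc k) `` {u}"
      by (auto simp: walk_le_def atMost_Suc)
    also have "card \<dots> \<le> card (walk_le E k `` {u}) + card ((E ^^ Suc k) `` {u})"
      by (rule card_Un_le)
    also have "\<dots> \<le> d ^ k + (d - 1) * d ^ k"
      using Suc sphere[of k] by (rule add_mono)
    \<comment> \<open>Assumption \<open>u\<close> excludes \<open>d = 0\<close>, where the truncated
      \<open>d - 1\<close> would spoil the identity at \<open>k = 0\<close>.\<close>
    also have "\<dots> = d ^ Suc k"
      using u by (cases d) auto
    finally show ?case .
  qed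
qed

section \<open>Graphs of large girth\<close>

text \<open>For symmetric irreflexive relations: the girth is at least \<open>a + 2\<close>.\<close>

definition detour_free :: "nat \<Rightarrow> 'a rel \<Rightarrow> bool" where
  "detour_free a E \<longleftrightarrow> (\<forall>x y. (x, y) \<in> E \<longrightarrow> (x, y) \<notin> walk_le (E - {(x, y), (y, x)}) a)"

text \<open>A short detour of the new edge would be a short walk from \<open>u\<close> to
  \<open>v\<close> in \<open>E\<close>. A short detour of an old edge \<open>(x, y)\<close> must
  cross the new one; exchanging the roles of the two edges in the resulting closed walk again gives
  a short walk from \<open>u\<close> to \<open>v\<close> in \<open>E\<close>.\<close>

lemma detour_free_insert_edge:
  assumes "sym E" "detour_free a E" and far: "(u, v) \<notin> walk_le E a"
  shows "detour_free a (E \<union> {(u, v), (v, u)})"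
  unfolding detour_free_def
proof (intro allI impI notI)
  let ?E' = "E \<union> {(u, v), (v, u)}"
  fix x y
  assume xy: "(x, y) \<in> ?E'" and w: "(x, y) \<in> walk_le (?E' - {(x, y), (y, x)}) a"
  show False
  proof (cases "(x, y) \<in> {(u, v), (v, u)}")
    case True
    then have "(x, y) \<in> walk_le E a"
      using w walk_le_mono[of "?E' - {(x, y), (y, x)}" E a] by auto
    with True far show False
      using walk_le_sym[OF \<open>sym E\<close>] by blast
  next
    case False
    then have xyE: "(x, y) \<in> E" using xy by auto
    let ?F = "E - {(x, y), (y, x)}"
    have "?E' - {(x, y), (y, x)} \<subseteq> ?F \<union> {(u, v), (v, u)}" by auto
    then have "(x, y) \<in> walk_le (?F \<union> {(u, v), (v, u)}) a"
      using w by (rule subsetD[OF walk_le_mono])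
    then obtain k where k: "k \<le> a" "(x, y) \<in> (?F \<union> {(u, v), (v, u)}) ^^ k"
      by (auto simp: walk_le_def)
    have "(x, y) \<notin> walk_le ?F a"
      using xyE assms(2) by (auto simp: detour_free_def)
    then have "(x, y) \<notin> walk_le ?F k"
      using k(1) by (auto simp: walk_le_def)
    then obtain i j where ij: "i + j + 1 \<le> k"
      "(x, u) \<in> ?F ^^ i \<and> (v, y) \<in> ?F ^^ j \<or> (x, v) \<in> ?F ^^ i \<and> (u, y) \<in> ?F ^^ j"
      using relpow_insert_edge[OF k(2)] by blast
    have F: "?F ^^ m \<subseteq> E ^^ m" for m
      by (rule relpow_mono) blast
    \<comment> \<open>The exchange: the old edge takes the place of the single crossing of
      \<open>u v\<close>, so the total length \<open>i' + j' + 1\<close> is unchanged.\<close>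
    have join: "(p, q) \<in> walk_le E a"
      if "(p, s) \<in> E ^^ i'" "(s, t) \<in> E" "(t, q) \<in> E ^^ j'" "i' + j' + 1 \<le> k" for p q s t i' j'
    proof -
      have "(p, q) \<in> E ^^ (Suc i' + j')"
        using that(1-3) unfolding relpow_add by auto
      then show ?thesis
        by (rule walk_leI) (use that(4) k(1) in simp)
    qed
    have sym: "(q, p) \<in> E ^^ m" if "(p, q) \<in> E ^^ m" for p q m
      using relpow_sym[OF \<open>sym E\<close> that] .
    have "(y, x) \<in> E" using xyE \<open>sym E\<close> by (meson symD)
    from ij(2) show False
    proof (elim disjE conjE)
      assume "(x, u) \<in> ?F ^^ i" "(v, y) \<in> ?F ^^ j"
      then have "(u, x) \<in> E ^^ i" "(y, v) \<in> E ^^ j"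
        using F sym by blast+
      from join[OF this(1) xyE this(2)] far ij(1) show False by blast
    next
      assume "(x, v) \<in> ?F ^^ i" "(u, y) \<in> ?F ^^ j"
      then have "(x, v) \<in> E ^^ i" "(u, y) \<in> E ^^ j"
        using F by blast+
      from join[OF this(2) \<open>(y, x) \<in> E\<close> this(1)] far ij(1) show False by simp
    qed
  qed
qed

lemma card_insert_edge_Image:
  assumes "finite E" "sym E" "(u, v) \<notin> E" "u \<noteq> v"
  shows "card ((E \<union> {(u, v), (v, u)}) `` {w}) \<le> card (E `` {w}) + (if w \<in> {u, v} then 1 else 0)"
proof -
  have "(E \<union> {(u, v), (v, u)}) `` {w} =
      (if w = u then insert v (E `` {w}) else if w = v then insert u (E `` {w}) else E `` {w})"
    using \<open>u \<noteq> v\<close> by auto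
  then show ?thesis
    using card_insert_le_m1 by (auto simp: card_insert_if assms(1))
qed

text \<open>Vertices outside the small set \<open>U\<close> of unsaturated ones have degree exactly
  \<open>d\<close>. As \<open>E\<close> consists of ordered pairs, the degree sum is
  \<open>card E\<close> itself, twice the number of edges.\<close>

lemma exists_dense_detour_free:
  fixes V :: "'a set"
  assumes "finite V" "1 \<le> a"
  obtains E where "E \<subseteq> V \<times> V" "sym E" "irrefl E" "detour_free a E"
    "(card V - d ^ a) * d \<le> card E"
proof -
  define \<C> where "\<C> = {E. E \<subseteq> V \<times> V \<and> sym E \<and> irrefl E \<and> detour_free a E \<and>
    (\<forall>v. card (E `` {v}) \<le> d)}"
  have "\<C> \<subseteq> Pow (V \<times> V)" by (auto simp: \<C>_def)
  then have "finite \<C>" by (rule finite_subset) (use assms in simp)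
  moreover have "{} \<in> \<C>"
    by (auto simp: \<C>_def sym_def irrefl_def detour_free_def)
  ultimately obtain E where "E \<in> \<C>" and max: "\<And>E'. E' \<in> \<C> \<Longrightarrow> E \<subseteq> E' \<Longrightarrow> E = E'"
    using finite_has_maximal[of \<C>] by blast
  then have E: "E \<subseteq> V \<times> V" "sym E" "irrefl E" "detour_free a E" and
    deg: "\<And>v. card (E `` {v}) \<le> d"
    by (auto simp: \<C>_def)
  have fin: "finite E" using E(1) assms(1) finite_subset by blast
  define U where "U = {v \<in> V. card (E `` {v}) < d}"
  have near: "(u, v) \<in> walk_le E a" if uv: "u \<in> U" "v \<in> U" for u v
  proof (rule ccontr)
    assume far: "(u, v) \<notin> walk_le E a"
    \<comment> \<open>Lengths 0 and 1 are instances of \<open>far\<close>: they show that the new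
      edge is no loop and is really new, which maximality needs.\<close>
    have "(u, v) \<notin> E ^^ 0"
      using far walk_leI[where x=u and y=v and E=E and i=0 and k=a] by auto
    then have "u \<noteq> v" by simp
    have "(u, v) \<notin> E ^^ 1"
      using far walk_leI[where x=u and y=v and E=E and i=1 and k=a] \<open>1 \<le> a\<close> by auto
    then have "(u, v) \<notin> E" by simp
    let ?E' = "E \<union> {(u, v), (v, u)}"
    have "card (?E' `` {w}) \<le> d" for w
      using card_insert_edge_Image[OF fin E(2) \<open>(u, v) \<notin> E\<close> \<open>u \<noteq> v\<close>, of w] deg[of w] uv
      by (auto simp: U_def split: if_splits)
    moreover have "sym ?E'" "irrefl ?E'" "?E' \<subseteq> V \<times> V"
      using E uv \<open>u \<noteq> v\<close> by (auto simp: sym_def irrefl_def U_def)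
    ultimately have "?E' \<in> \<C>"
      using detour_free_insert_edge[OF E(2,4) far] by (auto simp: \<C>_def)
    then show False
      using max[of ?E'] \<open>(u, v) \<notin> E\<close> by blast
  qed
  have "card U \<le> d ^ a"
  proof (cases "U = {}")
    case False
    then obtain u where "u \<in> U" by blast
    then have "U \<subseteq> walk_le E a `` {u}" using near by blast
    moreover have "finite (walk_le E a `` {u})"
      using finite_relpow_Image[OF fin, of _ u] by (auto simp: walk_le_def UN_Image)
    ultimately have "card U \<le> card (walk_le E a `` {u})"
      by (meson card_mono)
    also have "\<dots> \<le> d ^ a"
      using card_walk_le_bound[OF fin deg] \<open>u \<in> U\<close> by (auto simp: U_def)
    finally show ?thesis .
  qed simp
  moreover have "card (V - U) = card V - card U"
    using assms(1) by (intro card_Diff_subset) (auto simp: U_def)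
  ultimately have "(card V - d ^ a) * d \<le> card (V - U) * d"
    by (intro mult_right_mono) auto
  also have "\<dots> = (\<Sum>v\<in>V - U. d)" by simp
  also have "\<dots> \<le> (\<Sum>v\<in>V - U. card (E `` {v}))"
    by (rule sum_mono) (auto simp: U_def)
  also have "\<dots> \<le> (\<Sum>v\<in>V. card (E `` {v}))"
    by (rule sum_mono2) (use assms in auto)
  also have "\<dots> = card (SIGMA v:V. E `` {v})"
    using assms(1) finite_relpow_Image[OF fin, of 1] by simp
  also have "(SIGMA v:V. E `` {v}) = E"
    using E(1) by auto
  finally show thesis using that E by blast
qed

lemma exists_bipartite_detour_free:
  obtains E :: "nat rel" where "E \<subseteq> {..<n} \<times> {..<n}" "sym E" "irrefl E" "detour_free 2 E"
    "card E = 2 * (n div 2) * (n - n div 2)"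
proof -
  define A B where "A = {..<n div 2}" and "B = {n div 2..<n}"
  let ?E = "A \<times> B \<union> B \<times> A"
  have disj: "A \<inter> B = {}" by (auto simp: A_def B_def)
  \<comment> \<open>Walks of length 0 and 2 stay on the side where they start, and a walk of length
    1 would be the deleted edge.\<close>
  have "(x, y) \<notin> walk_le (?E - {(x, y), (y, x)}) 2" if "(x, y) \<in> ?E" for x y
    using that disj by (auto simp: walk_le_def numeral_2_eq_2 atMost_Suc)
  then have "detour_free 2 ?E" by (auto simp: detour_free_def)
  moreover have "card ?E = card A * card B + card B * card A"
    using disj by (subst card_Un_disjoint) (auto simp: A_def B_def card_cartesian_product)
  then have "card ?E = 2 * (n div 2) * (n - n div 2)"
    by (simp add: A_def B_def)
  moreover have "?E \<subseteq> {..<n} \<times> {..<n}" by (auto simp: A_def B_def)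
  moreover have "sym ?E" "irrefl ?E" using disj by (auto simp: sym_def irrefl_def)
  ultimately show thesis using that by blast
qed

section \<open>Counting labellings\<close>

lemma graph_dist_arc_le:
  assumes "pair_graph G" "(x, y) \<in> parcs G"
  shows "graph_dist G x y \<le> 1"
proof -
  interpret pair_graph G by fact
  have "awalk x [(x, y)] y"
    using arc_implies_awalk[OF assms(2)] by simp
  from min_cost_le_walk_cost[OF this, of "\<lambda>_. 1"] show ?thesis
    by (simp add: graph_dist_def one_ereal_def)
qed

lemma graph_dist_refl_le:
  assumes "pair_graph G" "x \<in> pverts G"
  shows "graph_dist G x x \<le> 1"
proof -
  interpret pair_graph G by fact
  have "awalk x [] x"
    using assms(2) by (simp add: awalk_Nil_iff)
  from min_cost_le_walk_cost[OF this, of "\<lambda>_. 1"] have "graph_dist G x x \<le> 0"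
    by (simp add: graph_dist_def zero_ereal_def[symmetric])
  also have "\<dots> \<le> 1" by simp
  finally show ?thesis .
qed

text \<open>With unit weights every walk costs its number of arcs, an integer. Without a walk of
  length at most \<open>a\<close>, the infimum is thus at least \<open>a + 1\<close>, also when
  there is no walk at all.\<close>

lemma graph_dist_greater:
  assumes "pair_graph G" "(x, y) \<notin> walk_le (parcs G) a" "\<alpha> < real a + 1"
  shows "ereal \<alpha> < graph_dist G x y"
proof -
  interpret pair_graph G by fact
  have rel: "(u, v) \<in> parcs G ^^ length p" if "awalk u p v" for u p v
    using that
  proof (induction p arbitrary: u)
    case (Cons e p)
    then have "(u, snd e) \<in> parcs G" "(snd e, v) \<in> parcs G ^^ length p"
      by (auto simp: awalk_Cons_iff)
    then show ?case by (metis length_Cons relpow_Suc_I2)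
  qed (simp add: awalk_Nil_iff)
  have "ereal (real a + 1) \<le> ereal (awalk_cost (\<lambda>_. 1) p)" if "awalk x p y" for p
  proof -
    have "\<not> length p \<le> a"
      using rel[OF that] assms(2) walk_leI by metis
    then show ?thesis by (simp add: awalk_cost_def sum_list_triv)
  qed
  then have "ereal (real a + 1) \<le> graph_dist G x y"
    unfolding graph_dist_def \<mu>_def by (intro INF_greatest) auto
  moreover have "ereal \<alpha> < ereal (real a + 1)" using assms(3) by simp
  ultimately show ?thesis by (rule less_le_trans[rotated])
qed

section \<open>Encoding subgraphs by their labellings\<close>

lemma pair_graph_sym_closure:
  assumes "finite V" "S \<subseteq> V \<times> V" "irrefl S"
  shows "pair_graph \<lparr>pverts = V, parcs = S \<union> S\<inverse>\<rparr>"
proof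
  show "symmetric (with_proj \<lparr>pverts = V, parcs = S \<union> S\<inverse>\<rparr>)"
    by (auto simp: symmetric_def sym_def)
  show "finite (parcs \<lparr>pverts = V, parcs = S \<union> S\<inverse>\<rparr>)"
    using assms(1,2) finite_subset[of S "V \<times> V"] by simp
qed (use assms in \<open>auto simp: irrefl_def\<close>)

lemma card_bitstrings_le_less: "card {xs :: bitstring. length xs \<le> l} < 2 ^ (l + 1)"
proof -
  have "card {xs :: bitstring. length xs \<le> l} = (\<Sum>i\<le>l. 2 ^ i)"
    using card_lists_length_le[of "UNIV :: bool set" l] by simp
  also have "\<dots> < 2 ^ (l + 1)"
    by (induction l) auto
  finally show ?thesis .
qed

text \<open>The \<open>2 ^ card P\<close> subgraphs of \<open>E\<close> receive pairwise different
  labellings, because the common decoder recovers the edges kept. Fewer than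
  \<open>2 ^ (l + 1)\<close> labels are available per vertex, which makes the bound strict.\<close>

lemma card_detour_free_less:
  fixes E :: "'a::linorder rel"
  assumes V: "finite V" "V \<noteq> {}"
    and E: "E \<subseteq> V \<times> V" "sym E" "irrefl E" "detour_free a E"
    and \<alpha>: "\<alpha> < real a + 1"
    and lab: "\<And>G. pair_graph G \<Longrightarrow> pverts G = V \<Longrightarrow> distance_labelling \<alpha> D G (L G)"
    and len: "\<And>G x. pair_graph G \<Longrightarrow> pverts G = V \<Longrightarrow> x \<in> V \<Longrightarrow> length (L G x) \<le> l"
  shows "card E < 2 * ((l + 1) * card V)"
proof -
  \<comment> \<open>The order selects one orientation of each edge, so subsets of \<open>P\<close>
    correspond to subgraphs without repetition.\<close>
  define P where "P = {(x, y) \<in> E. x < y}"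
  define H where "H = (\<lambda>S. \<lparr>pverts = V, parcs = S \<union> S\<inverse>\<rparr>)"
  \<comment> \<open>Labels outside \<open>V\<close> are unconstrained; restriction puts the
    labellings into a finite function space.\<close>
  define f where "f = (\<lambda>S. restrict (L (H S)) V)"
  have finE: "finite E" using E(1) V(1) finite_subset by blast
  have PE: "P \<subseteq> E" by (auto simp: P_def)
  have "finite P" using finE PE finite_subset by blast
  have "E = P \<union> P\<inverse>"
    using E(2,3) by (auto simp: P_def irrefl_def dest: symD)
  moreover have "P \<inter> P\<inverse> = {}" by (auto simp: P_def)
  ultimately have cardE: "card E = 2 * card P"
    using card_Un_disjoint[of P "P\<inverse>"] \<open>finite P\<close> by (simp add: card_inverse)
  have H: "pair_graph (H S)" "pverts (H S) = V" if "S \<subseteq> P" for S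
  proof -
    have "S \<subseteq> V \<times> V" "irrefl S"
      using that PE E(1,3) by (auto simp: irrefl_def)
    then show "pair_graph (H S)"
      using pair_graph_sym_closure[OF V(1)] by (simp add: H_def)
  qed (simp add: H_def)
  have kept: "S \<subseteq> T" if ST: "S \<subseteq> P" "T \<subseteq> P" "f S = f T" for S T
  proof
    fix e assume "e \<in> S"
    obtain x y where e: "e = (x, y)" by (cases e)
    have xy: "(x, y) \<in> E" "x < y" "x \<in> V" "y \<in> V"
      using \<open>e \<in> S\<close> e ST(1) E(1) by (auto simp: P_def)
    have "graph_dist (H S) x y \<le> 1"
      using graph_dist_arc_le[OF H(1)[OF ST(1)], of x y] \<open>e \<in> S\<close> e by (auto simp: H_def)
    then have "D (L (H S) x) (L (H S) y)"
      using lab[OF H[OF ST(1)]] xy H(2)[OF ST(1)] by (auto simp: distance_labelling_def)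
    moreover have "L (H S) z = L (H T) z" if "z \<in> V" for z
      using fun_cong[OF ST(3), of z] that by (simp add: f_def)
    ultimately have "D (L (H T) x) (L (H T) y)"
      using xy by simp
    then have *: "\<not> ereal \<alpha> < graph_dist (H T) x y"
      using lab[OF H[OF ST(2)]] xy H(2)[OF ST(2)] by (auto simp: distance_labelling_def)
    show "e \<in> T"
    proof (rule ccontr)
      \<comment> \<open>Then \<open>H T\<close> lies in \<open>E\<close> without this edge, so its
        endpoints are further apart than \<alpha> and the decoder must reject labels that it
        accepted for \<open>H S\<close>.\<close>
      assume "e \<notin> T"
      then have "T \<union> T\<inverse> \<subseteq> E - {(x, y), (y, x)}"
        using ST(2) e E(2) xy(2) by (auto simp: P_def dest: symD)
      then have "(x, y) \<notin> walk_le (T \<union> T\<inverse>) a"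
        using E(4) xy(1) walk_le_mono unfolding detour_free_def by blast
      then show False
        using * graph_dist_greater[OF H(1)[OF ST(2)] _ \<alpha>] by (auto simp: H_def)
    qed
  qed
  then have "inj_on f (Pow P)"
    by (intro inj_onI subset_antisym) simp_all
  moreover have "f ` Pow P \<subseteq> V \<rightarrow>\<^sub>E {xs. length xs \<le> l}"
    using len H by (auto simp: f_def)
  moreover have finl: "finite {xs :: bitstring. length xs \<le> l}"
    using finite_lists_length_le[of "UNIV :: bool set" l] by simp
  ultimately have "card (Pow P) \<le> card (V \<rightarrow>\<^sub>E {xs :: bitstring. length xs \<le> l})"
    using V(1) by (intro card_inj_on_le[of f]) (auto intro: finite_PiE)
  also have "\<dots> = card {xs :: bitstring. length xs \<le> l} ^ card V"
    using V(1) by (rule card_funcsetE)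
  also have "\<dots> < (2 ^ (l + 1)) ^ card V"
    using card_bitstrings_le_less V by (intro power_strict_mono) (auto simp: card_gt_0_iff)
  finally have "(2 :: nat) ^ card P < 2 ^ ((l + 1) * card V)"
    by (simp only: card_Pow[OF \<open>finite P\<close>] power_mult)
  then have "card P < (l + 1) * card V"
    by (rule power_less_imp_less_exp[rotated]) simp
  then show ?thesis using cardE by simp
qed

section \<open>Enough edges from the numerical assumptions\<close>

lemma exists_dense_girth_graph:
  fixes n l a :: nat
  assumes "2 \<le> a" "1 \<le> l" and n: "(9 * l) ^ a < n"
  obtains E :: "nat rel" where "E \<subseteq> {..<n} \<times> {..<n}" "sym E" "irrefl E" "detour_free a E"
    "2 * ((l + 1) * n) \<le> card E"
proof (cases "a = 2")
  case True
  obtain E :: "nat rel" where E: "E \<subseteq> {..<n} \<times> {..<n}" "sym E" "irrefl E" "detour_free 2 E"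
    "card E = 2 * (n div 2) * (n - n div 2)"
    by (rule exists_bipartite_detour_free)
  have "81 * (l * l) < n"
    using n True by (simp add: power2_eq_square)
  moreover have "81 * l \<le> 81 * (l * l)" by simp
  ultimately have "81 * l < n"
    by (rule le_less_trans[rotated])
  \<comment> \<open>Only \<open>4 * l + 4 \<le> n\<close> is essential, so that the smaller side has
    at least \<open>2 * (l + 1)\<close> vertices; the larger side has at least
    \<open>n / 2\<close>.\<close>
  then have "4 * l + 6 \<le> n"
    using assms(2) by linarith
  then have "2 * (l + 1) \<le> n div 2"
    by (simp add: less_eq_div_iff_mult_less_eq)
  then have "2 * (l + 1) * n \<le> (n div 2) * n"
    by (rule mult_right_mono) simp
  also have "\<dots> \<le> (n div 2) * (2 * (n - n div 2))"
    by (rule mult_left_mono) linarith+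
  finally have "2 * ((l + 1) * n) \<le> card E"
    using E(5) by (simp add: ac_simps)
  then show thesis using that E True by blast
next
  case False
  then have "3 \<le> a" using assms(1) by simp
  obtain E :: "nat rel" where E: "E \<subseteq> {..<n} \<times> {..<n}" "sym E" "irrefl E" "detour_free a E"
    "(n - (6 * l) ^ a) * (6 * l) \<le> card E"
    using exists_dense_detour_free[of "{..<n}" a "6 * l"] assms(1) by auto
  \<comment> \<open>That is, \<open>(6 / 9) ^ a\<close> is at most \<open>8 / 27\<close> for
    \<open>a \<ge> 3\<close>. So \<open>(6 * l) ^ a\<close> is below \<open>8 * n / 27\<close>, more
    than two thirds of the vertices are saturated, and at degree \<open>6 * l\<close> they supply at
    least \<open>4 * l * n\<close> ordered pairs.\<close>
  have "27 * 6 ^ a \<le> 8 * (9 :: nat) ^ a"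
    using \<open>3 \<le> a\<close> by (induction a rule: dec_induct) auto
  then have "27 * (6 * l) ^ a \<le> 8 * (9 * l) ^ a"
    by (simp add: power_mult_distrib)
  then have "2 * n \<le> 3 * (n - (6 * l) ^ a)"
    using n by linarith
  then have *: "2 * n * (2 * l) \<le> 3 * (n - (6 * l) ^ a) * (2 * l)"
    by (rule mult_right_mono) simp
  have "(l + 1) * n \<le> 2 * l * n"
    using assms(2) by (intro mult_right_mono) auto
  then have "2 * ((l + 1) * n) \<le> 2 * n * (2 * l)"
    by (simp add: ac_simps)
  also note *
  also have "3 * (n - (6 * l) ^ a) * (2 * l) = (n - (6 * l) ^ a) * (6 * l)"
    by simp
  finally have "2 * ((l + 1) * n) \<le> (n - (6 * l) ^ a) * (6 * l)" .
  then show thesis using that E by force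
qed

section \<open>The class of all graphs on \<open>n\<close> vertices and the final
  contradiction\<close>

lemma graph_class_all_graphs: "graph_class {G. pair_graph G \<and> card (pverts G) = n}"
proof -
  have "pair_graph H \<and> card (pverts H) = card (pverts G)"
    if "pair_graph G" and iso: "digraph_iso (with_proj G) (with_proj H)"
    for G H :: "nat pair_pre_digraph"
  proof -
    interpret pair_graph G by fact
    obtain h where h: "digraph_isomorphism h" and H: "with_proj H = app_iso h (with_proj G)"
      using iso unfolding digraph_iso_def by blast
    \<comment> \<open>A digraph isomorphism may rename arcs freely. Since the image is again a graph
      of pairs, its arc map is forced to be the one induced by the vertex map.\<close>
    have [simp]: "iso_tail h = fst" "iso_head h = snd"
      using arg_cong[OF H, of tail] arg_cong[OF H, of head] by auto
    have inj: "inj_on (iso_verts h) (pverts G)"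
      using digraph_isomorphism_inj_on_verts[OF h] by simp
    have pv: "pverts H = iso_verts h ` pverts G"
      using arg_cong[OF H, of verts] by simp
    have "iso_arcs h e = map_prod (iso_verts h) (iso_verts h) e" if "e \<in> parcs G" for e
      using iso_verts_tail[OF h, of e] iso_verts_head[OF h, of e] that
      by (auto simp: prod_eq_iff)
    then have pa: "parcs H = map_prod (iso_verts h) (iso_verts h) ` parcs G"
      using arg_cong[OF H, of arcs] by simp
    have "pair_graph H"
    proof
      show "symmetric (with_proj H)"
        using pair_sym_arcs unfolding symmetric_def pa with_proj_simps sym_def by auto
      show "fst e \<noteq> snd e" if e: "e \<in> parcs H" for e
      proof -
        obtain x y where "(x, y) \<in> parcs G" "e = (iso_verts h x, iso_verts h y)"
          using e pa by auto
        then show ?thesis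
          using pair_no_loops[of "(x, y)"] inj in_arcsD1 in_arcsD2 by (auto simp: inj_on_eq_iff)
      qed
    qed (auto simp: pv pa pair_finite_verts pair_finite_arcs in_arcsD1 in_arcsD2)
    then show ?thesis
      using card_image[OF inj] pv by simp
  qed
  then show ?thesis
    by (auto simp: graph_class_def)
qed

theorem theorem5p4:
  fixes \<alpha> :: real and n :: nat
  assumes "\<alpha> \<ge> 2" and "n \<ge> 2"
  shows "\<exists>F :: nat pair_pre_digraph set.
    graph_class F \<and> (\<forall>G\<in>F. card (pverts G) = n) \<and>
    (\<forall>D L. distance_labelling_scheme \<alpha> F D L \<longrightarrow>
      (\<exists>G\<in>F. \<exists>x\<in>pverts G. real (length (L G x)) \<ge> 1 / 9 * real n powr (1 / \<alpha>)))"
proof (intro exI conjI allI impI)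
  let ?F = "{G :: nat pair_pre_digraph. pair_graph G \<and> card (pverts G) = n}"
  show "graph_class ?F" by (rule graph_class_all_graphs)
  show "\<forall>G\<in>?F. card (pverts G) = n" by simp
  fix D L
  assume scheme: "distance_labelling_scheme \<alpha> ?F D L"
  let ?r = "real n powr (1 / \<alpha>)"
  show "\<exists>G\<in>?F. \<exists>x\<in>pverts G. real (length (L G x)) \<ge> 1 / 9 * ?r"
  proof (rule ccontr)
    assume neg: "\<not> ?thesis"
    \<comment> \<open>The largest natural number strictly below \<open>?r / 9\<close>: it bounds
      every label length, while \<open>9 * l < ?r\<close> stays strict.\<close>
    define l where "l = nat \<lceil>?r / 9\<rceil> - 1"
    have "?r > 0" using assms by simp
    then have c: "\<lceil>?r / 9\<rceil> \<ge> 1" by linarith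
    have l9: "9 * real l < ?r"
      unfolding l_def using c by linarith
    have len: "length (L G x) \<le> l"
      if "pair_graph G" "pverts G = {..<n}" "x \<in> {..<n}" for G x
    proof -
      have "real (length (L G x)) < ?r / 9"
        using neg that by (auto simp: not_le)
      then have "int (length (L G x)) < \<lceil>?r / 9\<rceil>" by linarith
      then show ?thesis unfolding l_def by linarith
    qed
    have lab: "distance_labelling \<alpha> D G (L G)" if "pair_graph G" "pverts G = {..<n}" for G
      using scheme that by (simp add: distance_labelling_scheme_def)
    show False
    proof (cases "l = 0")
      case True
      \<comment> \<open>All labels are empty, so \<open>D [] []\<close> would have to accept the
        pair \<open>0, 0\<close> and reject the pair \<open>0, 1\<close> at infinite
        distance.\<close>
      let ?G = "\<lparr>pverts = {..<n}, parcs = {}\<rparr> :: nat pair_pre_digraph"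
      have G: "pair_graph ?G"
        using pair_graph_sym_closure[of "{..<n}" "{} :: nat rel"] by (simp add: irrefl_def)
      have L: "L ?G 0 = []" "L ?G 1 = []"
        using len[OF G] True assms by auto
      have dist: "(graph_dist ?G x y \<le> 1 \<longrightarrow> D (L ?G x) (L ?G y)) \<and>
          (ereal \<alpha> < graph_dist ?G x y \<longrightarrow> \<not> D (L ?G x) (L ?G y))" if "x < n" "y < n" for x y
        using lab[OF G] that by (simp add: distance_labelling_def)
      have "(0, 1) \<notin> walk_le ({} :: nat rel) (nat \<lfloor>\<alpha>\<rfloor>)"
        by (auto simp: walk_le_def gr0_conv_Suc elim!: relpow_E2)
      then have "ereal \<alpha> < graph_dist ?G 0 1"
        using graph_dist_greater[OF G, of 0 1 "nat \<lfloor>\<alpha>\<rfloor>" \<alpha>] assms(1) by simp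
      then have "\<not> D [] []"
        using dist[of 0 1] L assms(2) by simp
      moreover have "graph_dist ?G 0 0 \<le> 1"
        using graph_dist_refl_le[OF G, of 0] assms(2) by simp
      then have "D [] []"
        using dist[of 0 0] L assms(2) by simp
      ultimately show False by simp
    next
      case False
      define a where "a = nat \<lfloor>\<alpha>\<rfloor>"
      have a: "2 \<le> a" "real a \<le> \<alpha>" "\<alpha> < real a + 1"
        unfolding a_def using assms(1) by linarith+
      \<comment> \<open>Rounding \<alpha> down is harmless because the base \<open>9 * l\<close> is
        at least 1; raising \<open>9 * l < ?r\<close> to the power \<alpha> then gives
        \<open>n\<close>.\<close>
      have "real ((9 * l) ^ a) = (9 * real l) powr real a"
        using False by (simp add: powr_realpow)
      also have "\<dots> \<le> (9 * real l) powr \<alpha>"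
        using False a(2) by (intro powr_mono) auto
      also have "\<dots> < ?r powr \<alpha>"
        using l9 assms(1) by (intro powr_less_mono2) auto
      also have "\<dots> = real n"
        using assms by (simp add: powr_powr)
      finally have "(9 * l) ^ a < n"
        unfolding of_nat_less_iff .
      then obtain E :: "nat rel" where E: "E \<subseteq> {..<n} \<times> {..<n}" "sym E" "irrefl E"
        "detour_free a E" "2 * ((l + 1) * n) \<le> card E"
        using exists_dense_girth_graph[of a l n] a(1) False by auto
      have "card E < 2 * ((l + 1) * card {..<n})"
        by (rule card_detour_free_less[OF _ _ E(1-4) a(3) lab len]) (use assms in \<open>auto simp: lessThan_empty_iff\<close>)
      with E(5) show False by simp
    qed
  qed
qed

end
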